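(* Let $m<n$, let $G$ be an arbitrarily chosen set of subsets $g\subset\{1,\ldots,n\}$ with $|g|=m$, and consider the Bell expression $\sum_{g\in G}\mathcal{I}^{g}$, where each $\mathcal{I}^{g}$ is an $m$-partite Bell expression detecting genuine multipartite nonlocality (GMNL) between the parties $\{A_i\}_{i\in g}$, lifted to the $n$-partite scenario. Suppose that the following two conditions are satisfied by $\mathcal{I}^g$ for each $g\in G$. (i) For all correlations $\vec p$ that are local across a bipartition $S|\bar S$ of $\{A_1,\ldots,A_n\}$, one has $\mathcal{I}^{g}\leqslant 0$ if there exists a pair $i,j\in g$ such that $A_i\in S$ and $A_j\in\bar S$. (ii) Writing $\mathcal{I}^{g}=\mathcal{I}^{g}_{+}-\mathcal{I}^{g}_{-}$, where $\mathcal{I}^{g}_{+}$ and $\mathcal{I}^{g}_{-}$ collect the probabilities that enter $\mathcal{I}^{g}$ with positive and negative signs, respectively (so that both contain probabilities only with positive weights), the positive parts are all the same: $\mathcal{I}^{g}_{+}=\mathcal{I}^{g'}_{+}=:\mathcal{I}_{+}$ for all $g\neq g'\in G$. Let $T$ be the common term appearing in all the negative parts $\mathcal{I}^{g}_{-}$, $g\in G$. For a partition of $\{A_1,\ldots,A_n\}$ into disjoint nonempty sets $S_1,\ldots,S_L$ let $$G'=\{g\in G \,:\, \{A_i\}_{i\in g}\subset S_l \text{ for some } l\in\{1,\ldots,L\}\},$$ and let $\gamma_k=\max_{S_1,\ldots,S_L}|G'|$, the maximum being over all such partitions with $|S_l|\leqslant k$ for all $l$. Then violation of the Bell inequality $$\sum_{g\in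 G}\mathcal{I}^{g}\leqslant\gamma_k\,(\mathcal{I}_{+}-T)$$ by correlations $p(\boldsymbol a|\boldsymbol x)$ implies that those correlations have nonlocality depth $k+1$.
   Context: Scenario. There are $n$ parties $A_1,\ldots,A_n$. Each party $A_i$ performs one of finitely many measurements, labelled $x_i$, and obtains one of finitely many outcomes, labelled $a_i$. Correlations are a family $\vec p=\{p(\boldsymbol a|\boldsymbol x)\}$ of probability distributions, where $\boldsymbol a=(a_1,\ldots,a_n)$ and $\boldsymbol x=(x_1,\ldots,x_n)$. For a set $S$ of parties, $\boldsymbol a_S,\boldsymbol x_S$ denote the outcomes and measurement choices of the parties in $S$. The no-signaling principle means that the marginal distribution of the outcomes of any subset of the parties does not depend on the measurement choices of the other parties. Locality across a bipartition and GMNL. A bipartition $S|\bar S$ is a partition of the set of parties into two disjoint nonempty sets. Correlations $\vec p$ are local across $S|\bar S$ if $$p(\boldsymbol a|\boldsymbol x)=\sum_\lambda q_\lambda\, p_S(\boldsymbol a_S|\boldsymbol x_S,\lambda)\,p_{\bar S}(\boldsymbol a_{\bar S}|\boldsymbol x_{\bar S},\lambda),$$ where $q_\lambda$ is a probability distribution and $p_S(\cdot|\cdot,\lambda)$, $p_{\bar S}(\cdot|\cdot,\lambda)$ are probability distributions satisfying the no-signaling principle. Correlations are genuinely multipartite nonlocal (GMNL) if they are not a convex combination, over bipartitions, of correlations local across bipartitions. A Bell expression detects GMNL if violation of the associated Bell inequality (bounding the expression by $0$) certifies that the correlations are GMNL; for two parties GMNL is ordinary Bell nonlocality. Nonlocality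 depth. An $L_k$ partition is a partition of $\{A_1,\ldots,A_n\}$ into $L$ disjoint nonempty sets $S_1,\ldots,S_L$ with $|S_l|\leqslant k$ for all $l$, where $k\in\{1,\ldots,n\}$. Correlations are $k$-producible with respect to this $L_k$ partition if $$p(\boldsymbol a|\boldsymbol x)=\sum_\lambda q_\lambda\, p_{S_1}(\boldsymbol a_{S_1}|\boldsymbol x_{S_1},\lambda)\cdots p_{S_L}(\boldsymbol a_{S_L}|\boldsymbol x_{S_L},\lambda),$$ where $q_\lambda$ is a probability distribution and each $p_{S_l}(\cdot|\cdot,\lambda)$ satisfies the no-signaling conditions between the parties in $S_l$. Correlations are $k$-producible if they are a convex combination of correlations that are $k$-producible with respect to various $L_k$ partitions. The nonlocality depth of correlations is the minimal $k$ for which they are $k$-producible. Bell expressions. A Bell expression is a real linear combination of the probabilities $p(\boldsymbol a|\boldsymbol x)$. An $m$-partite Bell expression for the parties $\{A_i\}_{i\in g}$ is lifted to the $n$-partite scenario by fixing the measurement choices and outcomes of the remaining $n-m$ parties (for example, all equal to $0$), i.e. by replacing each $m$-partite probability by the $n$-partite probability in which the remaining parties have these fixed measurement choices and outcomes. The common term $T$ is the combination of probabilities that is common to all the negative parts: every $\mathcal{I}^g_-$ is the sum of $T$ and remaining terms (with positive weights) that differ for different $g$; in particular $T=0$ if the $\mathcal{I}^g_-$ share no common terms.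
   Formalization: The conclusion "have nonlocality depth k+1" is proved as "nonlocality depth at least k+1" (not k-producible), since exact equality is false in general: correlations of depth 3 can violate the inequality for k=1. *)

theory Defs
  imports Complex_Main "HOL-Library.FuncSet" "HOL-Library.Disjoint_Sets"
    "HOL-Library.Extended_Nat"
begin

text \<open>
  Parties are natural numbers. Party \<open>i\<close> has the set \<open>X i\<close> of measurements and the set \<open>A i\<close> of
  outcomes. Joint outcomes and measurement choices of a set \<open>P\<close> of parties are the elements of
  \<open>PiE P A\<close> and \<open>PiE P X\<close>; the subtuples \<open>a\<^sub>S\<close>, \<open>x\<^sub>S\<close> are \<open>restrict a S\<close>, \<open>restrict x S\<close>.
  Families \<open>p a x\<close> (read p(a|x)) and coefficient functions are meaningful on these sets only.
\<close>

type_synonym ('a, 'x) family = "(nat \<Rightarrow> 'a) \<Rightarrow> (nat \<Rightarrow> 'x) \<Rightarrow> real"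

definition correlations ::
  "(nat \<Rightarrow> 'a set) \<Rightarrow> (nat \<Rightarrow> 'x set) \<Rightarrow> nat set \<Rightarrow> ('a, 'x) family \<Rightarrow> bool" where
  "correlations A X P p \<longleftrightarrow>
     (\<forall>x\<in>PiE P X. (\<forall>a\<in>PiE P A. 0 \<le> p a x) \<and> (\<Sum>a\<in>PiE P A. p a x) = 1)"

definition marginal ::
  "(nat \<Rightarrow> 'a set) \<Rightarrow> nat set \<Rightarrow> nat set \<Rightarrow> ('a, 'x) family \<Rightarrow> ('a, 'x) family" where
  "marginal A P U p b x = (\<Sum>a\<in>{a \<in> PiE P A. restrict a U = b}. p a x)"

definition no_signaling ::
  "(nat \<Rightarrow> 'a set) \<Rightarrow> (nat \<Rightarrow> 'x set) \<Rightarrow> nat set \<Rightarrow> ('a, 'x) family \<Rightarrow> bool" where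
  "no_signaling A X P p \<longleftrightarrow>
     (\<forall>U\<subseteq>P. \<forall>x\<in>PiE P X. \<forall>x'\<in>PiE P X. restrict x U = restrict x' U \<longrightarrow>
        (\<forall>b\<in>PiE U A. marginal A P U p b x = marginal A P U p b x'))"

definition prob_weights :: "nat \<Rightarrow> (nat \<Rightarrow> real) \<Rightarrow> bool" where
  "prob_weights N q \<longleftrightarrow> (\<forall>l<N. 0 \<le> q l) \<and> (\<Sum>l<N. q l) = 1"

definition convex_combination_of ::
  "(nat \<Rightarrow> 'a set) \<Rightarrow> (nat \<Rightarrow> 'x set) \<Rightarrow> nat set \<Rightarrow> (('a, 'x) family \<Rightarrow> bool) \<Rightarrow>
   ('a, 'x) family \<Rightarrow> bool" where
  "convex_combination_of A X P Q p \<longleftrightarrow>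
     (\<exists>N w r. prob_weights N w \<and> (\<forall>l<N. Q (r l)) \<and>
        (\<forall>a\<in>PiE P A. \<forall>x\<in>PiE P X. p a x = (\<Sum>l<N. w l * r l a x)))"

definition bipartition :: "nat set \<Rightarrow> nat set \<Rightarrow> nat set \<Rightarrow> bool" where
  "bipartition P S S' \<longleftrightarrow> S \<noteq> {} \<and> S' \<noteq> {} \<and> S \<inter> S' = {} \<and> S \<union> S' = P"

definition local_across ::
  "(nat \<Rightarrow> 'a set) \<Rightarrow> (nat \<Rightarrow> 'x set) \<Rightarrow> nat set \<Rightarrow> nat set \<Rightarrow> ('a, 'x) family \<Rightarrow> bool" where
  "local_across A X S S' p \<longleftrightarrow>
     (\<exists>N q pS pS'. prob_weights N q \<and>
        (\<forall>l<N. correlations A X S (pS l) \<and> no_signaling A X S (pS l) \<and>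
               correlations A X S' (pS' l) \<and> no_signaling A X S' (pS' l)) \<and>
        (\<forall>a\<in>PiE (S \<union> S') A. \<forall>x\<in>PiE (S \<union> S') X.
           p a x = (\<Sum>l<N. q l * pS l (restrict a S) (restrict x S)
                               * pS' l (restrict a S') (restrict x S'))))"

definition gmnl ::
  "(nat \<Rightarrow> 'a set) \<Rightarrow> (nat \<Rightarrow> 'x set) \<Rightarrow> nat set \<Rightarrow> ('a, 'x) family \<Rightarrow> bool" where
  "gmnl A X P p \<longleftrightarrow>
     \<not> convex_combination_of A X P
         (\<lambda>r. \<exists>S S'. bipartition P S S' \<and> local_across A X S S' r) p"

definition producible_wrt ::
  "(nat \<Rightarrow> 'a set) \<Rightarrow> (nat \<Rightarrow> 'x set) \<Rightarrow> nat set set \<Rightarrow> ('a, 'x) family \<Rightarrow> bool" where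
  "producible_wrt A X \<P> p \<longleftrightarrow>
     (\<exists>N q pS. prob_weights N q \<and>
        (\<forall>l<N. \<forall>S\<in>\<P>. correlations A X S (pS S l) \<and> no_signaling A X S (pS S l)) \<and>
        (\<forall>a\<in>PiE (\<Union>\<P>) A. \<forall>x\<in>PiE (\<Union>\<P>) X.
           p a x = (\<Sum>l<N. q l * (\<Prod>S\<in>\<P>. pS S l (restrict a S) (restrict x S)))))"

definition k_partition :: "nat \<Rightarrow> nat \<Rightarrow> nat set set \<Rightarrow> bool" where
  "k_partition n k \<P> \<longleftrightarrow> partition_on {1..n} \<P> \<and> (\<forall>S\<in>\<P>. card S \<le> k)"

definition k_producible ::
  "nat \<Rightarrow> (nat \<Rightarrow> 'a set) \<Rightarrow> (nat \<Rightarrow> 'x set) \<Rightarrow> nat \<Rightarrow> ('a, 'x) family \<Rightarrow> bool" where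
  "k_producible n A X k p \<longleftrightarrow>
     convex_combination_of A X {1..n} (\<lambda>r. \<exists>\<P>. k_partition n k \<P> \<and> producible_wrt A X \<P> r) p"

text \<open>
  The infimum in \<^typ>\<open>enat\<close> is the minimum whenever some admissible \<open>k\<close> exists. Signaling
  correlations are not \<open>k\<close>-producible for any \<open>k\<close>; their depth is \<open>\<infinity>\<close>.
\<close>

definition nonlocality_depth ::
  "nat \<Rightarrow> (nat \<Rightarrow> 'a set) \<Rightarrow> (nat \<Rightarrow> 'x set) \<Rightarrow> ('a, 'x) family \<Rightarrow> enat" where
  "nonlocality_depth n A X p = (INF k\<in>{k \<in> {1..n}. k_producible n A X k p}. enat k)"

text \<open>
  A Bell expression is represented by its coefficients: \<open>c a x\<close> is the weight of p(a|x).
\<close>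

type_synonym ('a, 'x) bell_expr = "(nat \<Rightarrow> 'a) \<Rightarrow> (nat \<Rightarrow> 'x) \<Rightarrow> real"

definition bell_value ::
  "(nat \<Rightarrow> 'a set) \<Rightarrow> (nat \<Rightarrow> 'x set) \<Rightarrow> nat set \<Rightarrow> ('a, 'x) bell_expr \<Rightarrow> ('a, 'x) family \<Rightarrow> real"
  where "bell_value A X P c p = (\<Sum>a\<in>PiE P A. \<Sum>x\<in>PiE P X. c a x * p a x)"

definition detects_gmnl ::
  "(nat \<Rightarrow> 'a set) \<Rightarrow> (nat \<Rightarrow> 'x set) \<Rightarrow> nat set \<Rightarrow> ('a, 'x) bell_expr \<Rightarrow> bool" where
  "detects_gmnl A X P c \<longleftrightarrow>
     (\<forall>p. correlations A X P p \<longrightarrow> bell_value A X P c p > 0 \<longrightarrow> gmnl A X P p)"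

text \<open>
  Lifting from the parties \<open>g\<close> to the parties \<open>P\<close>: only probabilities in which the parties outside
  \<open>g\<close> have the fixed outcomes \<open>a0\<close> and measurement choices \<open>x0\<close> occur.
\<close>

definition lift_expr ::
  "nat set \<Rightarrow> nat set \<Rightarrow> (nat \<Rightarrow> 'a) \<Rightarrow> (nat \<Rightarrow> 'x) \<Rightarrow> ('a, 'x) bell_expr \<Rightarrow> ('a, 'x) bell_expr" where
  "lift_expr P g a0 x0 c a x =
     (if \<forall>i\<in>P - g. a i = a0 i \<and> x i = x0 i then c (restrict a g) (restrict x g) else 0)"

definition pos_part :: "('a, 'x) bell_expr \<Rightarrow> ('a, 'x) bell_expr" where
  "pos_part c a x = max (c a x) 0"

definition neg_part :: "('a, 'x) bell_expr \<Rightarrow> ('a, 'x) bell_expr" where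
  "neg_part c a x = max (- c a x) 0"

text \<open>
  The weight with which p(a|x) occurs in all the negative parts simultaneously is the least of its
  weights in them, so this is the largest combination whose removal leaves nonnegative weights.
\<close>

definition common_term :: "nat set set \<Rightarrow> (nat set \<Rightarrow> ('a, 'x) bell_expr) \<Rightarrow> ('a, 'x) bell_expr" where
  "common_term G I a x = (if G = {} then 0 else Min ((\<lambda>g. neg_part (I g) a x) ` G))"

definition unsplit :: "nat set set \<Rightarrow> nat set set \<Rightarrow> nat set set" where
  "unsplit G \<P> = {g \<in> G. \<exists>S\<in>\<P>. g \<subseteq> S}"

definition gamma_bound :: "nat \<Rightarrow> nat set set \<Rightarrow> nat \<Rightarrow> nat" where
  "gamma_bound n G k = Max {card (unsplit G \<P>) | \<P>. k_partition n k \<P>}"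

end

theory Submission
  imports Defs
begin

text \<open>
  Every functional involved is linear, so it suffices to bound
  \<open>\<Sum>\<^sub>g I\<^sup>g\<close> on correlations that are \<open>k\<close>-producible with respect to a single partition.
  Grouping one block against all the others makes them local across a bipartition, so by
  condition (i) only the unsplit \<open>g\<close> contribute, each at most \<open>D = I\<^sub>+ - T\<close>. This gives
  \<open>|G'| D \<le> \<gamma>\<^sub>k D\<close> when \<open>D \<ge> 0\<close>. When \<open>D < 0\<close>, all \<open>g\<close> satisfy \<open>I\<^sup>g \<le> D\<close>, so the sum is at
  most \<open>|G| D \<le> \<gamma>\<^sub>k D\<close>.
\<close>

section \<open>Products of families on two disjoint sets of parties\<close>

lemma restrict_in_PiE: "a \<in> PiE P A \<Longrightarrow> S \<subseteq> P \<Longrightarrow> restrict a S \<in> PiE S A"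
  by (auto simp: PiE_iff)

text \<open>Gluing and restricting are mutually inverse between pairs of tuples on \<open>S\<close>
  and \<open>S'\<close> and tuples on the union. They match the fibre over \<open>b\<close> with the
  product of the fibres over its two restrictions, so the sum factors.\<close>

lemma sum_PiE_union_fibre:
  fixes f h :: "(nat \<Rightarrow> 'a) \<Rightarrow> real"
  assumes disj: "S \<inter> S' = {}" and U: "U \<subseteq> S \<union> S'" and b: "b \<in> PiE U A"
  shows "(\<Sum>a\<in>{a \<in> PiE (S \<union> S') A. restrict a U = b}. f (restrict a S) * h (restrict a S')) =
         (\<Sum>a\<in>{a \<in> PiE S A. restrict a (U \<inter> S) = restrict b (U \<inter> S)}. f a) *
         (\<Sum>a\<in>{a \<in> PiE S' A. restrict a (U \<inter> S') = restrict b (U \<inter> S')}. h a)"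
    (is "_ = sum f ?F * sum h ?F'")
proof -
  \<comment> \<open>Outside both sets the glued tuple takes the value of \<open>v\<close>, which is
    \<open>undefined\<close> there; this makes it extensional on the union.\<close>
  let ?join = "\<lambda>(u, v) i. if i \<in> S then u i else v i"
  have b_out: "b i = undefined" if "i \<notin> U" for i
    using b that by (auto simp: PiE_iff extensional_def)
  have "sum f ?F * sum h ?F' = (\<Sum>(u, v)\<in>?F \<times> ?F'. f u * h v)"
    by (simp add: sum_product sum.cartesian_product)
  also have "\<dots> = (\<Sum>a\<in>{a \<in> PiE (S \<union> S') A. restrict a U = b}.
                    f (restrict a S) * h (restrict a S'))"
  proof (rule sum.reindex_bij_witness[where i = "\<lambda>a. (restrict a S, restrict a S')" and j = ?join],
         goal_cases)
    case (1 z)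
    then show ?case
      using disj by (auto simp: fun_eq_iff restrict_def PiE_iff extensional_def)
  next
    case (2 z)
    obtain u v where z: "z = (u, v)" by (cases z)
    with 2 have u: "u \<in> PiE S A" and v: "v \<in> PiE S' A"
      and u_eq: "restrict u (U \<inter> S) = restrict b (U \<inter> S)"
      and v_eq: "restrict v (U \<inter> S') = restrict b (U \<inter> S')"
      by auto
    have ub: "u i = b i" if "i \<in> U" "i \<in> S" for i
      using fun_cong[OF u_eq, of i] that by simp
    have vb: "v i = b i" if "i \<in> U" "i \<in> S'" for i
      using fun_cong[OF v_eq, of i] that by simp
    have "?join z \<in> PiE (S \<union> S') A"
      using u v by (auto simp: z PiE_iff extensional_def)
    moreover have "restrict (?join z) U = b"
      using U ub vb b_out by (auto simp: z fun_eq_iff restrict_def)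
    ultimately show ?case by simp
  next
    case (3 a)
    then show ?case by (auto simp: fun_eq_iff PiE_iff extensional_def)
  next
    case (4 a)
    then have "a \<in> PiE (S \<union> S') A" "b = restrict a U"
      by simp_all
    then show ?case
      by (auto simp: restrict_in_PiE Int_ac)
  next
    case (5 z)
    then obtain u v where z: "z = (u, v)" and u: "u \<in> PiE S A" and v: "v \<in> PiE S' A"
      by auto
    have "restrict (?join z) S = u" "restrict (?join z) S' = v"
      using u v disj by (auto simp: z fun_eq_iff PiE_iff extensional_def)
    then show ?case by (simp add: z)
  qed
  finally show ?thesis by simp
qed

text \<open>Both properties of a product family come from this factorization: normalization from
  \<open>U = {}\<close>, no-signaling from general \<open>U\<close>.\<close>

lemma marginal_prod:
  assumes "S \<inter> S' = {}" "U \<subseteq> S \<union> S'" "b \<in> PiE U A"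
  shows "marginal A (S \<union> S') U
           (\<lambda>a x. p (restrict a S) (restrict x S) * q (restrict a S') (restrict x S')) b x =
         marginal A S (U \<inter> S) p (restrict b (U \<inter> S)) (restrict x S) *
         marginal A S' (U \<inter> S') q (restrict b (U \<inter> S')) (restrict x S')"
  unfolding marginal_def by (rule sum_PiE_union_fibre[OF assms])

text \<open>Every tuple restricts on the empty set to the constant \<open>undefined\<close>, so the
  fibre is everything and total mass becomes a case of \<open>marginal_prod\<close>.\<close>

lemma sum_eq_marginal_empty:
  "(\<Sum>a\<in>PiE P A. p a x) = marginal A P {} p (\<lambda>_. undefined) x"
  by (simp add: marginal_def restrict_def)

lemma correlations_prod:
  assumes disj: "S \<inter> S' = {}"
    and p: "correlations A X S p" and q: "correlations A X S' q"
  shows "correlations A X (S \<union> S')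
           (\<lambda>a x. p (restrict a S) (restrict x S) * q (restrict a S') (restrict x S'))"
proof -
  have "(\<Sum>a\<in>PiE (S \<union> S') A. p (restrict a S) (restrict x S) * q (restrict a S') (restrict x S')) = 1"
    if x: "x \<in> PiE (S \<union> S') X" for x
  proof -
    have "restrict x S \<in> PiE S X" "restrict x S' \<in> PiE S' X"
      using x by (auto intro: restrict_in_PiE)
    then have "marginal A S {} p (\<lambda>_. undefined) (restrict x S) = 1"
      "marginal A S' {} q (\<lambda>_. undefined) (restrict x S') = 1"
      using p q unfolding sum_eq_marginal_empty[symmetric] correlations_def by auto
    then have "marginal A (S \<union> S') {}
        (\<lambda>a x. p (restrict a S) (restrict x S) * q (restrict a S') (restrict x S'))
        (\<lambda>_. undefined) x = 1"
      by (subst marginal_prod[OF disj]) simp_all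
    then show ?thesis
      by (simp only: sum_eq_marginal_empty[symmetric])
  qed
  moreover have "0 \<le> p (restrict a S) (restrict x S) * q (restrict a S') (restrict x S')"
    if "a \<in> PiE (S \<union> S') A" "x \<in> PiE (S \<union> S') X" for a x
  proof -
    have "restrict a S \<in> PiE S A" "restrict a S' \<in> PiE S' A"
      "restrict x S \<in> PiE S X" "restrict x S' \<in> PiE S' X"
      using that by (auto intro: restrict_in_PiE)
    then show ?thesis
      using p q unfolding correlations_def by simp
  qed
  ultimately show ?thesis
    unfolding correlations_def by blast
qed

text \<open>Inputs that agree on \<open>U\<close> agree on its intersection with each factor's
  parties. Hence neither factor's marginal changes, and by \<open>marginal_prod\<close> neither does
  their product.\<close>

lemma no_signaling_prod:
  assumes disj: "S \<inter> S' = {}"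
    and p: "no_signaling A X S p" and q: "no_signaling A X S' q"
  shows "no_signaling A X (S \<union> S')
           (\<lambda>a x. p (restrict a S) (restrict x S) * q (restrict a S') (restrict x S'))"
  unfolding no_signaling_def
proof (intro allI ballI impI)
  fix U x x' b
  assume U: "U \<subseteq> S \<union> S'" and x: "x \<in> PiE (S \<union> S') X" and x': "x' \<in> PiE (S \<union> S') X"
    and eq: "restrict x U = restrict x' U" and b: "b \<in> PiE U A"
  \<comment> \<open>No-signaling of a factor on \<open>V\<close> speaks only of inputs restricted to
    \<open>V\<close>, so the agreement on \<open>U\<close> is recast for those.\<close>
  have eq': "restrict (restrict x V) (U \<inter> V) = restrict (restrict x' V) (U \<inter> V)" for V
    using eq unfolding fun_eq_iff restrict_def by auto metis
  have *: "marginal A V (U \<inter> V) f (restrict b (U \<inter> V)) (restrict x V) =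
           marginal A V (U \<inter> V) f (restrict b (U \<inter> V)) (restrict x' V)"
    if "no_signaling A X V f" "V \<subseteq> S \<union> S'" for V f
    using that(1) eq'[of V] restrict_in_PiE[OF x that(2)] restrict_in_PiE[OF x' that(2)]
      restrict_in_PiE[OF b Int_lower1[of U V]]
    unfolding no_signaling_def by simp
  show "marginal A (S \<union> S') U
          (\<lambda>a x. p (restrict a S) (restrict x S) * q (restrict a S') (restrict x S')) b x =
        marginal A (S \<union> S') U
          (\<lambda>a x. p (restrict a S) (restrict x S) * q (restrict a S') (restrict x S')) b x'"
    unfolding marginal_prod[OF disj U b] using *[OF p] *[OF q] by simp
qed

section \<open>Products over many blocks, and producible correlations\<close>

definition block_product :: "nat set set \<Rightarrow> (nat set \<Rightarrow> ('a, 'x) family) \<Rightarrow> ('a, 'x) family" where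
  "block_product \<Q> f a x = (\<Prod>S\<in>\<Q>. f S (restrict a S) (restrict x S))"

text \<open>Supplies the restrictions to the union of the blocks that the two-factor lemmas have in
  their second factor.\<close>

lemma block_product_restrict:
  assumes "\<Union>\<Q> \<subseteq> V"
  shows "block_product \<Q> f (restrict a V) (restrict x V) = block_product \<Q> f a x"
proof -
  have "V \<inter> S = S" if "S \<in> \<Q>" for S
    using assms that by auto
  then show ?thesis
    unfolding block_product_def by (intro prod.cong) auto
qed

text \<open>Induction on the blocks: a new block is disjoint from the union of the earlier ones, so
  the two-factor lemmas apply to it and the product built so far.\<close>

lemma block_product_no_signaling_correlations:
  assumes "finite \<Q>" "disjoint \<Q>"
    and "\<And>S. S \<in> \<Q> \<Longrightarrow> correlations A X S (f S) \<and> no_signaling A X S (f S)"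
  shows "correlations A X (\<Union>\<Q>) (block_product \<Q> f) \<and>
         no_signaling A X (\<Union>\<Q>) (block_product \<Q> f)"
  using assms
proof (induction \<Q> rule: finite_induct)
  \<comment> \<open>Without parties there is a single outcome tuple, and the empty product gives it
    probability 1.\<close>
  case empty
  show ?case
    by (auto simp: correlations_def no_signaling_def block_product_def)
next
  case (insert S \<Q>)
  have IH: "correlations A X (\<Union>\<Q>) (block_product \<Q> f)"
    "no_signaling A X (\<Union>\<Q>) (block_product \<Q> f)"
    using insert by (auto simp: disjoint_def)
  have S: "correlations A X S (f S)" "no_signaling A X S (f S)"
    using insert.prems by auto
  have disj: "S \<inter> \<Union>\<Q> = {}"
    using insert.prems(1) insert.hyps(2) by (auto simp: disjoint_def)
  have eq: "block_product (insert S \<Q>) f =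
      (\<lambda>a x. f S (restrict a S) (restrict x S) *
             block_product \<Q> f (restrict a (\<Union>\<Q>)) (restrict x (\<Union>\<Q>)))"
    using insert.hyps by (simp add: fun_eq_iff block_product_restrict) (simp add: block_product_def)
  show ?case
    unfolding eq Union_insert
    using correlations_prod[OF disj S(1) IH(1)] no_signaling_prod[OF disj S(2) IH(2)] by simp
qed

lemma correlations_convex_sum:
  assumes w: "prob_weights N w" and r: "\<And>l. l < N \<Longrightarrow> correlations A X P (r l)"
    and p: "\<And>a x. a \<in> PiE P A \<Longrightarrow> x \<in> PiE P X \<Longrightarrow> p a x = (\<Sum>l<N. w l * r l a x)"
  shows "correlations A X P p"
  unfolding correlations_def
proof (intro ballI conjI)
  fix x assume x: "x \<in> PiE P X"
  show "0 \<le> p a x" if "a \<in> PiE P A" for a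
    unfolding p[OF that x] using w r x that
    by (auto simp: prob_weights_def correlations_def intro!: sum_nonneg mult_nonneg_nonneg)
  have "(\<Sum>a\<in>PiE P A. p a x) = (\<Sum>a\<in>PiE P A. \<Sum>l<N. w l * r l a x)"
    using p x by simp
  also have "\<dots> = (\<Sum>l<N. w l * (\<Sum>a\<in>PiE P A. r l a x))"
    by (subst sum.swap) (simp add: sum_distrib_left)
  also have "\<dots> = (\<Sum>l<N. w l)"
    using r x by (simp add: correlations_def)
  finally show "(\<Sum>a\<in>PiE P A. p a x) = 1"
    using w by (simp add: prob_weights_def)
qed

text \<open>Condition (i) and the monotonicity of Bell values both ask for genuine correlations;
  producibility provides them, as a mixture of block products.\<close>

lemma producible_wrt_correlations:
  assumes "finite \<P>" "disjoint \<P>" "producible_wrt A X \<P> r"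
  shows "correlations A X (\<Union>\<P>) r"
proof -
  obtain N q f where q: "prob_weights N q"
    and f: "\<forall>l<N. \<forall>S\<in>\<P>. correlations A X S (f S l) \<and> no_signaling A X S (f S l)"
    and r: "\<forall>a\<in>PiE (\<Union>\<P>) A. \<forall>x\<in>PiE (\<Union>\<P>) X.
              r a x = (\<Sum>l<N. q l * (\<Prod>S\<in>\<P>. f S l (restrict a S) (restrict x S)))"
    using assms(3) unfolding producible_wrt_def by blast
  show ?thesis
  proof (rule correlations_convex_sum[OF q])
    show "correlations A X (\<Union>\<P>) (block_product \<P> (\<lambda>S. f S l))" if "l < N" for l
      using block_product_no_signaling_correlations[OF assms(1,2), of A X "\<lambda>S. f S l"] f that
      by blast
    show "r a x = (\<Sum>l<N. q l * block_product \<P> (\<lambda>S. f S l) a x)"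
      if "a \<in> PiE (\<Union>\<P>) A" "x \<in> PiE (\<Union>\<P>) X" for a x
      using r that by (simp add: block_product_def)
  qed
qed

text \<open>For each hidden value the factor of \<open>S\<close> is kept and the other factors are
  merged into one no-signaling family; the weights stay the same. The other side may be empty here;
  that it is not is settled where the lemma is applied.\<close>

lemma producible_wrt_local_across:
  assumes "finite \<P>" "disjoint \<P>" "producible_wrt A X \<P> r" "S \<in> \<P>"
  shows "local_across A X S (\<Union>(\<P> - {S})) r"
proof -
  obtain N q f where q: "prob_weights N q"
    and f: "\<forall>l<N. \<forall>S\<in>\<P>. correlations A X S (f S l) \<and> no_signaling A X S (f S l)"
    and r: "\<forall>a\<in>PiE (\<Union>\<P>) A. \<forall>x\<in>PiE (\<Union>\<P>) X.
              r a x = (\<Sum>l<N. q l * (\<Prod>S\<in>\<P>. f S l (restrict a S) (restrict x S)))"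
    using assms(3) unfolding producible_wrt_def by blast
  let ?\<Q> = "\<P> - {S}"
  have disj: "disjoint ?\<Q>"
    using assms(2) by (auto simp: disjoint_def)
  have un: "S \<union> \<Union>?\<Q> = \<Union>\<P>"
    using assms(4) by auto
  have split: "(\<Prod>S\<in>\<P>. f S l (restrict a S) (restrict x S)) =
      f S l (restrict a S) (restrict x S) *
      block_product ?\<Q> (\<lambda>S. f S l) (restrict a (\<Union>?\<Q>)) (restrict x (\<Union>?\<Q>))" for l a x
    using prod.remove[OF assms(1,4)] by (simp add: block_product_restrict) (simp add: block_product_def)
  have "correlations A X S (f S l) \<and> no_signaling A X S (f S l) \<and>
        correlations A X (\<Union>?\<Q>) (block_product ?\<Q> (\<lambda>S. f S l)) \<and>
        no_signaling A X (\<Union>?\<Q>) (block_product ?\<Q> (\<lambda>S. f S l))" if "l < N" for l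
    using block_product_no_signaling_correlations[OF _ disj, of A X "\<lambda>S. f S l"] f that assms(1,4)
    by auto
  moreover have "r a x = (\<Sum>l<N. q l * f S l (restrict a S) (restrict x S) *
      block_product ?\<Q> (\<lambda>S. f S l) (restrict a (\<Union>?\<Q>)) (restrict x (\<Union>?\<Q>)))"
    if "a \<in> PiE (S \<union> \<Union>?\<Q>) A" "x \<in> PiE (S \<union> \<Union>?\<Q>) X" for a x
    using r that unfolding un split mult.assoc by blast
  ultimately show ?thesis
    unfolding local_across_def
    by (intro exI[of _ N] exI[of _ q] exI[of _ "f S"]
          exI[of _ "\<lambda>l. block_product ?\<Q> (\<lambda>S. f S l)"] conjI[OF q] conjI allI impI ballI)
      simp_all
qed

section \<open>Bell values, change of block size, and the size of \<open>gamma_bound\<close>\<close>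

lemma bell_value_convex_sum:
  assumes "\<And>a x. a \<in> PiE P A \<Longrightarrow> x \<in> PiE P X \<Longrightarrow> p a x = (\<Sum>l<N. w l * r l a x)"
  shows "bell_value A X P c p = (\<Sum>l<N. w l * bell_value A X P c (r l))"
proof -
  have "bell_value A X P c p =
      (\<Sum>a\<in>PiE P A. \<Sum>x\<in>PiE P X. \<Sum>l<N. w l * (c a x * r l a x))"
    unfolding bell_value_def
    by (intro sum.cong refl) (simp add: assms sum_distrib_left mult.left_commute)
  also have "\<dots> = (\<Sum>l<N. \<Sum>a\<in>PiE P A. \<Sum>x\<in>PiE P X. w l * (c a x * r l a x))"
    \<comment> \<open>Fixing the inner range moves the sum over \<open>l\<close> outward past both
      others and keeps the rewriting from looping.\<close>
    by (simp only: sum.swap[where B = "{..<N}"])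
  finally show ?thesis
    by (simp add: bell_value_def sum_distrib_left)
qed

lemma bell_value_mono:
  assumes "correlations A X P r"
    and "\<And>a x. a \<in> PiE P A \<Longrightarrow> x \<in> PiE P X \<Longrightarrow> c a x \<le> d a x"
  shows "bell_value A X P c r \<le> bell_value A X P d r"
  unfolding bell_value_def
  by (intro sum_mono mult_right_mono) (use assms in \<open>auto simp: correlations_def\<close>)

lemma bell_value_diff:
  "bell_value A X P (\<lambda>a x. c a x - d a x) r = bell_value A X P c r - bell_value A X P d r"
  by (simp add: bell_value_def left_diff_distrib sum_subtractf)

lemma common_term_le_neg_part:
  assumes "finite G" "g \<in> G"
  shows "common_term G I a x \<le> neg_part (I g) a x"
  using assms by (auto simp: common_term_def intro!: Min_le)

text \<open>Blocks of size at most \<open>k'\<close> also have size at most \<open>k\<close>. Thus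
  excluding one \<open>k\<close> excludes all smaller values, as a lower bound on the depth
  requires.\<close>

lemma k_producible_mono:
  assumes "k' \<le> k" "k_producible n A X k' p"
  shows "k_producible n A X k p"
proof -
  have "k_partition n k \<P>" if "k_partition n k' \<P>" for \<P>
    using that assms(1) unfolding k_partition_def by (meson order_trans)
  then have step: "(\<exists>\<P>. k_partition n k \<P> \<and> producible_wrt A X \<P> r)"
    if "\<exists>\<P>. k_partition n k' \<P> \<and> producible_wrt A X \<P> r" for r
    using that by blast
  obtain N w r where "prob_weights N w"
    and "\<forall>l<N. \<exists>\<P>. k_partition n k' \<P> \<and> producible_wrt A X \<P> (r l)"
    and "\<forall>a\<in>PiE {1..n} A. \<forall>x\<in>PiE {1..n} X. p a x = (\<Sum>l<N. w l * r l a x)"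
    using assms(2) unfolding k_producible_def convex_combination_of_def by blast
  then show ?thesis
    unfolding k_producible_def convex_combination_of_def
    by (intro exI[of _ N] exI[of _ w] exI[of _ r] conjI) (simp_all add: step)
qed

text \<open>The set under \<open>Max\<close> is finite because no member exceeds
  \<open>card G\<close>, and nonempty because of the given partition.\<close>

lemma
  assumes "finite G" "k_partition n k \<P>"
  shows card_unsplit_le_gamma_bound: "card (unsplit G \<P>) \<le> gamma_bound n G k"
    and gamma_bound_le_card: "gamma_bound n G k \<le> card G"
proof -
  let ?C = "{card (unsplit G \<P>) | \<P>. k_partition n k \<P>}"
  have le: "card (unsplit G \<Q>) \<le> card G" for \<Q>
    using assms(1) by (intro card_mono) (auto simp: unsplit_def)
  then have fin: "finite ?C"
    by (intro finite_subset[of ?C "{..card G}"]) auto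
  show "card (unsplit G \<P>) \<le> gamma_bound n G k"
    unfolding gamma_bound_def using fin assms(2) by (intro Max_ge) auto
  show "gamma_bound n G k \<le> card G"
    unfolding gamma_bound_def using fin assms(2) le by (subst Max_le_iff) auto
qed

section \<open>From a single partition to the nonlocality depth\<close>

theorem theorem3:
  fixes n m k :: nat
    and A :: "nat \<Rightarrow> 'a set" and X :: "nat \<Rightarrow> 'x set"
    and G :: "nat set set"
    and J I :: "nat set \<Rightarrow> ('a, 'x) bell_expr"
    and a0 :: "nat set \<Rightarrow> nat \<Rightarrow> 'a" and x0 :: "nat set \<Rightarrow> nat \<Rightarrow> 'x"
    and Iplus :: "('a, 'x) bell_expr"
    and p :: "('a, 'x) family"
  assumes outcomes: "\<And>i. i \<in> {1..n} \<Longrightarrow> finite (A i) \<and> A i \<noteq> {}"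
    and measurements: "\<And>i. i \<in> {1..n} \<Longrightarrow> finite (X i) \<and> X i \<noteq> {}"
    and "m < n"
    and G: "G \<subseteq> {g. g \<subseteq> {1..n} \<and> card g = m}"
    and detect: "\<And>g. g \<in> G \<Longrightarrow> detects_gmnl A X g (J g)"
    and fixed: "\<And>g i. g \<in> G \<Longrightarrow> i \<in> {1..n} - g \<Longrightarrow> a0 g i \<in> A i \<and> x0 g i \<in> X i"
    and lifted: "\<And>g. g \<in> G \<Longrightarrow> I g = lift_expr {1..n} g (a0 g) (x0 g) (J g)"
    and cond_i: "\<And>g S S' r i j. g \<in> G \<Longrightarrow> bipartition {1..n} S S' \<Longrightarrow>
                   i \<in> g \<Longrightarrow> j \<in> g \<Longrightarrow> i \<in> S \<Longrightarrow> j \<in> S' \<Longrightarrow>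
                   correlations A X {1..n} r \<Longrightarrow> local_across A X S S' r \<Longrightarrow>
                   bell_value A X {1..n} (I g) r \<le> 0"
    and cond_ii: "\<And>g a x. g \<in> G \<Longrightarrow> a \<in> PiE {1..n} A \<Longrightarrow> x \<in> PiE {1..n} X \<Longrightarrow>
                    pos_part (I g) a x = Iplus a x"
    and k: "k \<in> {1..n}"
    and p: "correlations A X {1..n} p"
    and violation:
      "(\<Sum>g\<in>G. bell_value A X {1..n} (I g) p) >
         real (gamma_bound n G k) *
           (bell_value A X {1..n} Iplus p - bell_value A X {1..n} (common_term G I) p)"
  shows "nonlocality_depth n A X p \<ge> enat (k + 1)"
proof -
  let ?B = "bell_value A X {1..n}"
  let ?T = "common_term G I"
  let ?\<gamma> = "real (gamma_bound n G k)"
  let ?D = "\<lambda>r. ?B Iplus r - ?B ?T r"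
  have finG: "finite G"
    using G by (rule finite_subset) auto
  have bound: "(\<Sum>g\<in>G. ?B (I g) r) \<le> ?\<gamma> * ?D r"
    if \<P>: "k_partition n k \<P>" and prod: "producible_wrt A X \<P> r" for \<P> r
  proof -
    have part: "\<Union>\<P> = {1..n}" "disjoint \<P>" "\<And>S. S \<in> \<P> \<Longrightarrow> S \<noteq> {}"
      using \<P> by (auto simp: k_partition_def partition_on_def)
    have fin: "finite \<P>"
      using \<P> finite_elements[of "{1..n}" \<P>] by (auto simp: k_partition_def)
    have r: "correlations A X {1..n} r"
      using producible_wrt_correlations[OF fin part(2) prod] by (simp add: part(1))
    have le_D: "?B (I g) r \<le> ?D r" if g: "g \<in> G" for g
    proof -
      \<comment> \<open>Each coefficient is its positive part, equal to \<open>Iplus\<close>, minus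
        its negative part, which is at least the common term.\<close>
      have "I g a x \<le> Iplus a x - ?T a x" if "a \<in> PiE {1..n} A" "x \<in> PiE {1..n} X" for a x
        using cond_ii[OF g that] common_term_le_neg_part[OF finG g, of I a x]
        by (auto simp: pos_part_def neg_part_def)
      then show ?thesis
        unfolding bell_value_diff[symmetric] by (intro bell_value_mono[OF r])
    qed
    have le_0: "?B (I g) r \<le> 0" if g: "g \<in> G - unsplit G \<P>" for g
    proof -
      have gP: "g \<in> G" "\<And>S. S \<in> \<P> \<Longrightarrow> \<not> g \<subseteq> S"
        using g by (auto simp: unsplit_def)
      \<comment> \<open>This covers \<open>m = 0\<close>: since \<open>k\<close> lies in
        \<open>{1..n}\<close>, some block exists, and it would contain an empty \<open>g\<close>. So
        a split \<open>g\<close> has an element.\<close>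
      have "\<Union>\<P> \<noteq> {}"
        using k part(1) by auto
      then obtain S0 where "S0 \<in> \<P>" by auto
      with gP(2) obtain i where i: "i \<in> g" by blast
      have g_sub: "g \<subseteq> \<Union>\<P>"
        using G gP(1) part(1) by auto
      with i obtain S where S: "S \<in> \<P>" "i \<in> S" by auto
      \<comment> \<open>The pair \<open>i\<close>, \<open>j\<close> witnesses that \<open>S\<close>
        against the remaining blocks separates \<open>g\<close>; \<open>j\<close> also makes the
        second side nonempty.\<close>
      with gP(2) obtain j where j: "j \<in> g" "j \<notin> S" by blast
      let ?S' = "\<Union>(\<P> - {S})"
      have j': "j \<in> ?S'"
        using j g_sub by auto
      have "S \<inter> ?S' = {}"
        using part(2) S(1) by (auto simp: disjoint_def)
      then have "bipartition {1..n} S ?S'"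
        using S j' part(1) by (auto simp: bipartition_def)
      then show ?thesis
        using cond_i[OF gP(1) _ i j(1) S(2) j' r]
          producible_wrt_local_across[OF fin part(2) prod S(1)] by blast
    qed
    show ?thesis
    proof (cases "0 \<le> ?D r")
      case True
      have "(\<Sum>g\<in>G. ?B (I g) r) \<le> (\<Sum>g\<in>unsplit G \<P>. ?B (I g) r)"
      proof -
        have "(\<Sum>g\<in>G. ?B (I g) r) =
            (\<Sum>g\<in>G - unsplit G \<P>. ?B (I g) r) + (\<Sum>g\<in>unsplit G \<P>. ?B (I g) r)"
          using finG by (intro sum.subset_diff) (auto simp: unsplit_def)
        with sum_nonpos[of "G - unsplit G \<P>" "\<lambda>g. ?B (I g) r"] le_0 show ?thesis by simp
      qed
      also have "\<dots> \<le> real (card (unsplit G \<P>)) * ?D r"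
        using le_D by (intro sum_bounded_above) (auto simp: unsplit_def)
      also have "\<dots> \<le> ?\<gamma> * ?D r"
        using card_unsplit_le_gamma_bound[OF finG \<P>] True by (intro mult_right_mono) auto
      finally show ?thesis .
    next
      case False
      \<comment> \<open>For negative \<open>?D r\<close> the bound by \<open>?D r\<close> is sharper
        than the bound by 0, so it is used for split \<open>g\<close> too. Multiplication by
        \<open>?D r\<close> then reverses the comparison of \<open>gamma_bound\<close> with
        \<open>card G\<close>.\<close>
      have "(\<Sum>g\<in>G. ?B (I g) r) \<le> real (card G) * ?D r"
        using le_D by (intro sum_bounded_above) auto
      also have "\<dots> \<le> ?\<gamma> * ?D r"
        using gamma_bound_le_card[OF finG \<P>] False by (intro mult_right_mono_neg) auto
      finally show ?thesis .
    qed
  qed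
  have not_producible: "\<not> k_producible n A X k p"
  proof
    assume "k_producible n A X k p"
    then obtain N w r where w: "prob_weights N w"
      and r: "\<And>l. l < N \<Longrightarrow> \<exists>\<P>. k_partition n k \<P> \<and> producible_wrt A X \<P> (r l)"
      and pr: "\<And>a x. a \<in> PiE {1..n} A \<Longrightarrow> x \<in> PiE {1..n} X \<Longrightarrow> p a x = (\<Sum>l<N. w l * r l a x)"
      unfolding k_producible_def convex_combination_of_def by blast
    \<comment> \<open>Stated for arbitrary \<open>c\<close>, so that one decomposition of
      \<open>p\<close> serves every \<open>I g\<close>, \<open>Iplus\<close> and the common
      term.\<close>
    have lin: "?B c p = (\<Sum>l<N. w l * ?B c (r l))" for c
      using pr by (rule bell_value_convex_sum)
    have "(\<Sum>g\<in>G. ?B (I g) p) = (\<Sum>l<N. w l * (\<Sum>g\<in>G. ?B (I g) (r l)))"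
      unfolding lin by (subst sum.swap) (simp add: sum_distrib_left)
    also have "\<dots> \<le> (\<Sum>l<N. w l * (?\<gamma> * ?D (r l)))"
      using w r bound by (intro sum_mono mult_left_mono) (auto simp: prob_weights_def)
    also have "\<dots> = ?\<gamma> * ?D p"
      unfolding lin by (simp add: sum_distrib_left sum_subtractf[symmetric] algebra_simps)
    finally show False
      using violation by simp
  qed
  \<comment> \<open>Every admissible \<open>k'\<close> exceeds \<open>k\<close>, which bounds the
    infimum below by \<open>k + 1\<close>; if none is admissible, the infimum is infinite and the
    bound still holds.\<close>
  have "k + 1 \<le> k'" if "k_producible n A X k' p" for k'
    using not_producible k_producible_mono[of k' k n A X p] that by (cases "k' \<le> k") auto
  then show ?thesis
    unfolding nonlocality_depth_def by (intro INF_greatest) auto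
qed

end
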